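(* Consider the Mutual Information Reducing Iterations (MIRI): starting from an initial imputation $\mathbf{X}^{(0)}$, for each $t=1,\dots,T$ let $$\mathbf{g}_t\in\arg\min_{\mathbf{g}}\ \mathrm{D}\big[\mathbb{P}_{\mathbf{X}^{(t)}(\mathbf{g}),\mathbf{M}}\,\big\Vert\,\mathbb{P}_{\mathbf{X}^{(t-1)}}\otimes\mathbb{P}_{\mathbf{M}}\big]$$ be any minimizer over all imputers $\mathbf{g}$, and set $\mathbf{X}^{(t)}:=\mathbf{X}^{(t)}(\mathbf{g}_t)$. Then the mutual information between $\mathbf{X}^{(t)}$ and $\mathbf{M}$ is non-increasing after each iteration: for every $t=1,\dots,T$, $$\mathrm{I}(\mathbf{X}^{(t)};\mathbf{M})\le \mathrm{I}(\mathbf{X}^{(t-1)};\mathbf{M}).$$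
   Context: The true data $\mathbf{X}^*$ is a random vector with values in a subset of $\mathbb{R}^d$, and the missingness mask $\mathbf{M}=(M_1,\dots,M_d)$ is a random vector in $\{0,1\}^d$; $M_j=1$ means that component $j$ is observed and $M_j=0$ that it is missing. The setting is Missing Completely at Random: $\mathbf{X}^*$ is independent of $\mathbf{M}$. The symbol $\odot$ denotes the componentwise product and $1-\mathbf{M}$ is the componentwise complement. The initial imputation $\mathbf{X}^{(0)}$ is an $\mathbb{R}^d$-valued random vector with $\mathbf{M}\odot\mathbf{X}^{(0)}=\mathbf{M}\odot\mathbf{X}^*$ whose missing components have been filled in arbitrarily. Given $\mathbf{X}^{(t-1)}$, an imputer is a measurable map $\mathbf{g}:\mathbb{R}^d\times\mathbb{R}^d\times\{0,1\}^d\to\mathbb{R}^d$ used together with a random seed $\mathbf{Z}_0^{(t)}$ (an $\mathbb{R}^d$-valued random vector supplying the imputer's randomness), and the corresponding imputed vector is $$\mathbf{X}^{(t)}(\mathbf{g}):=\mathbf{M}\odot\mathbf{X}^{(t-1)}+(1-\mathbf{M})\odot\mathbf{g}(\mathbf{Z}_0^{(t)};\mathbf{X}^{(t-1)},\mathbf{M}).$$ $\mathbb{P}_{\mathbf{A}}$ denotes the law of $\mathbf{A}$, $\mathbb{P}_{\mathbf{A},\mathbf{B}}$ the joint law, $\otimes$ the product of measures, $\mathrm{D}[\mathbb{P}\Vert\mathbb{Q}]$ the Kullback–Leibler divergence ($+\infty$ if $\mathbb{P}\not\ll\mathbb{Q}$), and $\mathrm{I}(\mathbf{A};\mathbf{B})=\mathrm{D}[\mathbb{P}_{\mathbf{A},\mathbf{B}}\Vert\mathbb{P}_{\mathbf{A}}\otimes\mathbb{P}_{\mathbf{B}}]$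 the mutual information. *)

theory Defs
  imports "HOL-Probability.Probability"
begin

text \<open>
  Kullback-Leibler divergence of \<open>N\<close> from \<open>Q\<close>, with values in the extended reals and natural
  logarithm. The library's \<^const>\<open>KL_divergence\<close> takes the reference measure first and is
  real-valued, so it does not represent the value \<open>\<infinity>\<close>. For probability measures with \<open>N\<close>
  absolutely continuous w.r.t. \<open>Q\<close>, the negative part of the log-likelihood ratio is always
  \<open>N\<close>-integrable; hence its integral exists in \<open>[0, \<infinity>]\<close>, and it is \<open>\<infinity>\<close> exactly when the
  ratio is not integrable.
\<close>

definition kl_div :: "'a measure \<Rightarrow> 'a measure \<Rightarrow> ereal" where
  "kl_div N Q =
    (if absolutely_continuous Q N \<and> integrable N (\<lambda>x. ln (enn2real (RN_deriv Q N x)))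
     then ereal (KL_divergence (exp 1) Q N) else \<infinity>)"

definition mutual_info ::
  "'a measure \<Rightarrow> 'b measure \<Rightarrow> 'c measure \<Rightarrow> ('a \<Rightarrow> 'b) \<Rightarrow> ('a \<Rightarrow> 'c) \<Rightarrow> ereal" where
  "mutual_info P S T A B =
    kl_div (distr P (S \<Otimes>\<^sub>M T) (\<lambda>\<omega>. (A \<omega>, B \<omega>))) (distr P S A \<Otimes>\<^sub>M distr P T B)"

definition masks :: "(real ^ 'n) set" where
  "masks = {m. \<forall>j. m $ j \<in> {0, 1}}"

text \<open>The arguments of an imputer are the seed, the current imputed vector and the mask.\<close>

definition imputers :: "((real ^ 'n) \<times> (real ^ 'n) \<times> (real ^ 'n) \<Rightarrow> real ^ 'n) set" where
  "imputers = measurable (borel \<Otimes>\<^sub>M borel \<Otimes>\<^sub>M count_space masks) borel"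

text \<open>On \<^typ>\<open>real ^ 'n\<close>, \<open>*\<close> is the componentwise product and \<open>1\<close> the all-ones vector.\<close>

definition imputed ::
  "('a \<Rightarrow> real ^ 'n) \<Rightarrow> ('a \<Rightarrow> real ^ 'n) \<Rightarrow> ('a \<Rightarrow> real ^ 'n) \<Rightarrow>
   ((real ^ 'n) \<times> (real ^ 'n) \<times> (real ^ 'n) \<Rightarrow> real ^ 'n) \<Rightarrow> 'a \<Rightarrow> real ^ 'n" where
  "imputed M Z X g = (\<lambda>\<omega>. M \<omega> * X \<omega> + (1 - M \<omega>) * g (Z \<omega>, X \<omega>, M \<omega>))"

definition miri_objective ::
  "'a measure \<Rightarrow> ('a \<Rightarrow> real ^ 'n) \<Rightarrow> ('a \<Rightarrow> real ^ 'n) \<Rightarrow> ('a \<Rightarrow> real ^ 'n) \<Rightarrow>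
   ((real ^ 'n) \<times> (real ^ 'n) \<times> (real ^ 'n) \<Rightarrow> real ^ 'n) \<Rightarrow> ereal" where
  "miri_objective P M Z X g =
    kl_div (distr P (borel \<Otimes>\<^sub>M count_space masks) (\<lambda>\<omega>. (imputed M Z X g \<omega>, M \<omega>)))
      (distr P borel X \<Otimes>\<^sub>M distr P (count_space masks) M)"

end

theory Submission
  imports Defs
begin

text \<open>
  The imputer returning the current vector leaves it unchanged, so its objective value is
  \<open>I(X (t - 1); M)\<close>, which bounds the minimum from above. Conversely, let \<open>J\<close> be a joint law with marginals \<open>A\<close>, \<open>B\<close>, having
  density \<open>f\<close> with respect to \<open>Q \<Otimes> B\<close>, and let \<open>a\<close> be the density of \<open>A\<close> with respect to \<open>Q\<close>.
  Then \<open>J\<close> has density \<open>f / a\<close> with respect to \<open>A \<Otimes> B\<close>, so \<open>D(J \<parallel> A \<Otimes> B) = D(J \<parallel> Q \<Otimes> B) - D(A \<parallel> Q)\<close>,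
  and the objective of any imputer dominates the mutual information it produces.
\<close>

text \<open>Radon-Nikodym derivatives are unique almost everywhere, so any explicit density may
  replace the \<open>RN_deriv\<close> in \<open>kl_div\<close>; absolute continuity is then
  automatic.\<close>

lemma kl_div_density:
  fixes f :: "'a \<Rightarrow> real"
  assumes "prob_space Q" and f [measurable]: "f \<in> borel_measurable Q"
    and f0: "\<And>x. 0 \<le> f x"
  shows "kl_div (density Q f) Q =
    (if integrable (density Q f) (\<lambda>x. ln (f x))
     then ereal (\<integral>x. ln (f x) \<partial>density Q f) else \<infinity>)"
proof -
  interpret Q: prob_space Q by fact
  let ?N = "density Q f"
  have ac: "absolutely_continuous Q ?N"
    by (rule absolutely_continuousI_density) simp
  have "AE x in Q. ennreal (f x) = RN_deriv Q ?N x"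
    by (rule Q.RN_deriv_unique) auto
  then have "AE x in Q. f x = enn2real (RN_deriv Q ?N x)"
    by eventually_elim (metis enn2real_ennreal f0)
  then have eq: "AE x in ?N. ln (f x) = ln (enn2real (RN_deriv Q ?N x))"
    by (subst AE_density) auto
  have "integrable ?N (\<lambda>x. ln (enn2real (RN_deriv Q ?N x))) \<longleftrightarrow> integrable ?N (\<lambda>x. ln (f x))"
    by (rule integrable_cong_AE) (use eq in auto)
  moreover have "KL_divergence (exp 1) Q ?N = (\<integral>x. ln (f x) \<partial>?N)"
    unfolding KL_divergence_def entropy_density_def
    by (rule integral_cong_AE) (use eq in \<open>auto simp: log_def\<close>)
  ultimately show ?thesis
    using ac by (simp add: kl_div_def)
qed

text \<open>The product of \<open>f\<close> and \<open>1 / f\<close> is 1 where \<open>f\<close> is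
  positive and 0 elsewhere, since \<open>1 / 0 = 0\<close>; so the integral is at most the total
  mass of \<open>Q\<close>. This controls the negative parts of logarithms of densities.\<close>

lemma inverse_density:
  fixes f :: "'a \<Rightarrow> real"
  assumes "prob_space Q" and f [measurable]: "f \<in> borel_measurable Q"
    and f0: "\<And>x. 0 \<le> f x"
  shows "integrable (density Q f) (\<lambda>x. 1 / f x)"
    and "(\<integral>x. 1 / f x \<partial>density Q f) \<le> 1"
proof -
  interpret Q: prob_space Q by fact
  have "(\<integral>\<^sup>+x. ennreal (1 / f x) \<partial>density Q f) = (\<integral>\<^sup>+x. ennreal (f x) * ennreal (1 / f x) \<partial>Q)"
    by (rule nn_integral_density) auto
  also have "\<dots> \<le> (\<integral>\<^sup>+x. 1 \<partial>Q)"
    by (rule nn_integral_mono) (auto simp: f0 simp flip: ennreal_mult)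
  also have "\<dots> = 1"
    by (simp add: Q.emeasure_space_1)
  finally have le: "(\<integral>\<^sup>+x. ennreal (1 / f x) \<partial>density Q f) \<le> 1" .
  then show "integrable (density Q f) (\<lambda>x. 1 / f x)"
    by (intro integrableI_nonneg) (auto simp: f0 intro: le_less_trans)
  then show "(\<integral>x. 1 / f x \<partial>density Q f) \<le> 1"
    using le by (subst (asm) nn_integral_eq_integral) (auto simp: f0)
qed

text \<open>The gap between the two sides is the divergence of the first marginal from
  \<open>Q\<close>, which is nonnegative. The delicate point is that it is finite, so that the
  integrals may be subtracted.\<close>

lemma kl_div_marginal_le:
  fixes J :: "('a \<times> 'b) measure"
  assumes "prob_space J" "prob_space Q" and [simp]: "sets Q = sets S"
    and sJ: "sets J = sets (S \<Otimes>\<^sub>M T)"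
  shows "kl_div J (distr J S fst \<Otimes>\<^sub>M distr J T snd) \<le> kl_div J (Q \<Otimes>\<^sub>M distr J T snd)"
\<comment> \<open>Finiteness of the right-hand side supplies both the absolute continuity of
  \<open>J\<close> and the integrability of \<open>ln f\<close> below.\<close>
proof (cases "kl_div J (Q \<Otimes>\<^sub>M distr J T snd) = \<infinity>")
  case False
  define A where "A = distr J S fst"
  define B where "B = distr J T snd"
  note [measurable_cong] = sJ
  interpret J: prob_space J by fact
  interpret Q: prob_space Q by fact
  interpret A: prob_space A unfolding A_def by (rule J.prob_space_distr) simp
  interpret B: prob_space B unfolding B_def by (rule J.prob_space_distr) simp
  interpret QB: pair_prob_space Q B ..
  interpret AB: pair_prob_space A B ..
  have [simp, measurable_cong]: "sets A = sets S" "sets B = sets T" by (auto simp: A_def B_def)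
  have [measurable_cong]: "sets Q = sets S" by simp
  have [simp]: "space A = space S" "space B = space T" "space Q = space S"
    by (auto intro!: sets_eq_imp_space_eq)
  have spJ: "space J = space S \<times> space T"
    using sets_eq_imp_space_eq[OF sJ] by (simp add: space_pair_measure)
  have sQB: "sets (Q \<Otimes>\<^sub>M B) = sets (S \<Otimes>\<^sub>M T)"
    by (rule sets_pair_measure_cong) simp_all
  have sAB: "sets (A \<Otimes>\<^sub>M B) = sets (S \<Otimes>\<^sub>M T)"
    by (rule sets_pair_measure_cong) simp_all
  have acJ: "absolutely_continuous (Q \<Otimes>\<^sub>M B) J"
    using False unfolding kl_div_def B_def by metis
  obtain f where f [measurable]: "f \<in> borel_measurable (Q \<Otimes>\<^sub>M B)"
    and f_RN: "AE x in Q \<Otimes>\<^sub>M B. RN_deriv (Q \<Otimes>\<^sub>M B) J x = ennreal (f x)"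
    and f_pos: "AE x in J. 0 < f x" and f0: "\<And>x. 0 \<le> f x"
    by (rule QB.P.real_RN_deriv[OF J.finite_measure_axioms acJ]) (auto simp: sJ sQB)
  have Jf: "J = density (Q \<Otimes>\<^sub>M B) f"
  proof -
    have "J = density (Q \<Otimes>\<^sub>M B) (RN_deriv (Q \<Otimes>\<^sub>M B) J)"
      using QB.P.density_RN_deriv[OF acJ] by (simp add: sJ sQB)
    also have "\<dots> = density (Q \<Otimes>\<^sub>M B) f"
      by (rule density_cong) (use f_RN in auto)
    finally show ?thesis .
  qed
  \<comment> \<open>A \<open>Q\<close>-null set \<open>N\<close> yields the null cylinder
    \<open>N \<times> space T\<close>, whose measure under \<open>J\<close> is that of
    \<open>N\<close> under \<open>A\<close>.\<close>
  have acA: "absolutely_continuous Q A"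
    unfolding absolutely_continuous_def
  proof
    fix N assume "N \<in> null_sets Q"
    then have [measurable]: "N \<in> sets S" and N0: "emeasure Q N = 0" by auto
    have "N \<times> space T \<in> null_sets (Q \<Otimes>\<^sub>M B)"
      using N0 by (auto simp: null_sets_def B.emeasure_pair_measure_Times)
    then have "N \<times> space T \<in> null_sets J"
      using acJ by (auto simp: absolutely_continuous_def)
    moreover have "fst -` N \<inter> space J = N \<times> space T"
      using sets.sets_into_space[of N S] by (auto simp: spJ)
    ultimately show "N \<in> null_sets A"
      by (auto simp: null_sets_def A_def emeasure_distr)
  qed
  obtain a where a [measurable]: "a \<in> borel_measurable Q"
    and a_RN: "AE x in Q. RN_deriv Q A x = ennreal (a x)"
    and a_pos: "AE x in A. 0 < a x" and a0: "\<And>x. 0 \<le> a x"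
    by (rule Q.real_RN_deriv[OF A.finite_measure_axioms acA]) auto
  have Aa: "A = density Q a"
  proof -
    have "A = density Q (RN_deriv Q A)"
      using Q.density_RN_deriv[OF acA] by simp
    also have "\<dots> = density Q a"
      by (rule density_cong) (use a_RN in auto)
    finally show ?thesis .
  qed
  have a_pos': "AE z in J. 0 < a (fst z)"
    using a_pos unfolding A_def by (subst (asm) AE_distr_iff) auto
  have AB: "A \<Otimes>\<^sub>M B = density (Q \<Otimes>\<^sub>M B) (\<lambda>z. ennreal (a (fst z)))"
  proof -
    \<comment> \<open>Writing \<open>B\<close> as its own density with constant 1 brings the product
      into the form of \<open>pair_measure_density\<close>.\<close>
    have "density Q a \<Otimes>\<^sub>M density B (\<lambda>_. 1) = density (Q \<Otimes>\<^sub>M B) (\<lambda>(x,y). ennreal (a x) * 1)"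
      by (rule pair_measure_density)
        (auto simp: density_1 B.sigma_finite_measure_axioms)
    then show ?thesis
      by (simp add: density_1 Aa[symmetric] case_prod_beta')
  qed
  define h where "h z = f z / a (fst z)" for z
  have [measurable]: "f \<in> borel_measurable (S \<Otimes>\<^sub>M T)" "a \<in> borel_measurable S"
    using f a by (simp_all cong: measurable_cong_sets add: sQB)
  have h [measurable]: "h \<in> borel_measurable (S \<Otimes>\<^sub>M T)"
    unfolding h_def by measurable
  then have hAB: "h \<in> borel_measurable (A \<Otimes>\<^sub>M B)"
    by (simp cong: measurable_cong_sets add: sAB)
  have h0: "0 \<le> h z" for z by (simp add: h_def f0 a0)
  \<comment> \<open>Where \<open>a\<close> vanishes, \<open>h\<close> is 0 by the convention on
    division; \<open>f\<close> vanishes there too almost everywhere, so \<open>f = a * h\<close>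
    survives.\<close>
  have "AE z in Q \<Otimes>\<^sub>M B. 0 < f z \<longrightarrow> 0 < a (fst z)"
    using a_pos' unfolding Jf by (subst (asm) AE_density) auto
  then have *: "AE z in Q \<Otimes>\<^sub>M B. ennreal (f z) = ennreal (a (fst z)) * ennreal (h z)"
    by eventually_elim (use f0 a0 in \<open>force simp: h_def simp flip: ennreal_mult intro: antisym\<close>)
  have Jh: "J = density (A \<Otimes>\<^sub>M B) h"
  proof -
    have "density (A \<Otimes>\<^sub>M B) h = density (Q \<Otimes>\<^sub>M B) (\<lambda>z. ennreal (a (fst z)) * ennreal (h z))"
      unfolding AB by (rule density_density_eq) auto
    also have "\<dots> = J"
      unfolding Jf by (rule density_cong) (use * in auto)
    finally show ?thesis ..
  qed
  have kl_f: "kl_div J (Q \<Otimes>\<^sub>M B) =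
      (if integrable J (\<lambda>z. ln (f z)) then ereal (\<integral>z. ln (f z) \<partial>J) else \<infinity>)"
    using kl_div_density[OF QB.P.prob_space_axioms f f0] by (simp flip: Jf)
  have kl_h: "kl_div J (A \<Otimes>\<^sub>M B) =
      (if integrable J (\<lambda>z. ln (h z)) then ereal (\<integral>z. ln (h z) \<partial>J) else \<infinity>)"
    using kl_div_density[OF AB.P.prob_space_axioms hAB h0] by (simp flip: Jh)
  have int_f: "integrable J (\<lambda>z. ln (f z))"
    using False kl_f unfolding B_def by metis
  have inv_h: "integrable J (\<lambda>z. 1 / h z)"
    using inverse_density(1)[OF AB.P.prob_space_axioms hAB h0] by (simp flip: Jh)
  have "integrable A (\<lambda>x. 1 / a x)" "(\<integral>x. 1 / a x \<partial>A) \<le> 1"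
    using inverse_density[OF Q.prob_space_axioms a a0] by (simp_all flip: Aa)
  then have inv_a: "integrable J (\<lambda>z. 1 / a (fst z))" "(\<integral>z. 1 / a (fst z) \<partial>J) \<le> 1"
    unfolding A_def by (simp_all add: integrable_distr_eq integral_distr)
  have pos: "AE z in J. 0 < f z \<and> 0 < a (fst z)"
    using f_pos a_pos' by eventually_elim simp
  \<comment> \<open>Serves twice: to dominate \<open>ln a\<close> by integrable functions, and to
    show that its integral is nonnegative.\<close>
  have ln_inv: "- ln x \<le> 1 / x - 1" if "0 < x" for x :: real
    using ln_le_minus_one[of "1 / x"] that by (simp add: ln_div)
  have ln_h: "AE z in J. ln (h z) = ln (f z) - ln (a (fst z))"
    using pos by eventually_elim (simp add: h_def ln_div)
  \<comment> \<open>\<open>ln a\<close> lies between \<open>1 - 1/a\<close> and \<open>ln f + 1/h - 1\<close>.\<close>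
  have int_a: "integrable J (\<lambda>z. ln (a (fst z)))"
  proof (rule Bochner_Integration.integrable_bound)
    show "integrable J (\<lambda>z. 1 / a (fst z) + \<bar>ln (f z)\<bar> + 1 / h z)"
      using int_f inv_h inv_a(1) by auto
    show "AE z in J. norm (ln (a (fst z))) \<le> norm (1 / a (fst z) + \<bar>ln (f z)\<bar> + 1 / h z)"
      using pos ln_h
    proof eventually_elim
      case (elim z)
      then have "0 < h z" by (simp add: h_def)
      then have "0 < 1 / a (fst z)" "0 < 1 / h z" using elim by simp_all
      then show ?case
        using elim ln_inv[of "a (fst z)"] ln_inv[OF \<open>0 < h z\<close>]
        unfolding real_norm_def by linarith
    qed
  qed auto
  have int_h: "integrable J (\<lambda>z. ln (h z))"
    by (subst integrable_cong_AE[OF _ _ ln_h]) (use int_f int_a in auto)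
  \<comment> \<open>Gibbs' inequality: the integral of \<open>ln a\<close> is the divergence of
    \<open>A\<close> from \<open>Q\<close>.\<close>
  have "(\<integral>z. - ln (a (fst z)) \<partial>J) \<le> (\<integral>z. 1 / a (fst z) - 1 \<partial>J)"
    by (rule integral_mono_AE) (use int_a inv_a pos ln_inv in auto)
  also have "\<dots> \<le> 0"
    using inv_a by (simp add: J.prob_space)
  finally have "0 \<le> (\<integral>z. ln (a (fst z)) \<partial>J)"
    by simp
  moreover have "(\<integral>z. ln (h z) \<partial>J) = (\<integral>z. ln (f z) \<partial>J) - (\<integral>z. ln (a (fst z)) \<partial>J)"
    by (subst integral_cong_AE[OF _ _ ln_h]) (use int_f int_a in auto)
  ultimately show ?thesis
    using int_h int_f kl_f kl_h by (simp flip: A_def B_def)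
qed simp

lemma mutual_info_le_kl_div:
  assumes "prob_space P" and A: "A \<in> measurable P S" and B: "B \<in> measurable P T"
    and "prob_space Q" "sets Q = sets S"
  shows "mutual_info P S T A B
    \<le> kl_div (distr P (S \<Otimes>\<^sub>M T) (\<lambda>\<omega>. (A \<omega>, B \<omega>))) (Q \<Otimes>\<^sub>M distr P T B)"
proof -
  note [measurable] = A B
  let ?J = "distr P (S \<Otimes>\<^sub>M T) (\<lambda>\<omega>. (A \<omega>, B \<omega>))"
  have "distr ?J S fst = distr P S A" "distr ?J T snd = distr P T B"
    by (simp_all add: distr_distr o_def)
  moreover have "prob_space ?J"
    using assms(1) by (rule prob_space.prob_space_distr) simp
  ultimately show ?thesis
    using kl_div_marginal_le[of ?J Q S T] assms by (simp add: mutual_info_def)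
qed

text \<open>Componentwise multiplication is continuous on pairs of vectors, hence Borel.\<close>

lemma measurable_vec_times [measurable]:
  fixes f h :: "'a \<Rightarrow> real ^ 'n"
  assumes [measurable]: "f \<in> borel_measurable P" "h \<in> borel_measurable P"
  shows "(\<lambda>x. f x * h x) \<in> borel_measurable P"
proof -
  have "continuous_on UNIV (\<lambda>x :: (real ^ 'n) \<times> (real ^ 'n). fst x * snd x)"
    by (simp add: times_vec_def) (intro continuous_intros)
  from measurable_compose[OF borel_measurable_Pair[OF assms] borel_measurable_continuous_onI[OF this]]
  show ?thesis by simp
qed

lemma measurable_imputed:
  assumes X: "X \<in> borel_measurable P" and Z: "Z \<in> borel_measurable P"
    and M: "M \<in> measurable P (count_space masks)" and g: "g \<in> imputers"
  shows "imputed M Z X g \<in> borel_measurable P"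
proof -
  note [measurable] = X Z M g[unfolded imputers_def]
  \<comment> \<open>The mask also enters as a factor in a vector product, so it is needed as a Borel
    map; every map out of a count space into \<open>borel\<close> is measurable.\<close>
  have [measurable]: "M \<in> borel_measurable P"
    using measurable_compose[OF M, of "\<lambda>m. m" borel] by simp
  show ?thesis
    unfolding imputed_def by measurable
qed

theorem proposition1:
  fixes P :: "'a measure"
    and D :: "(real ^ 'n) set"
    and Xstar M :: "'a \<Rightarrow> real ^ 'n"
    and X Z :: "nat \<Rightarrow> 'a \<Rightarrow> real ^ 'n"
    and g :: "nat \<Rightarrow> (real ^ 'n) \<times> (real ^ 'n) \<times> (real ^ 'n) \<Rightarrow> real ^ 'n"
    and T :: nat
  assumes "prob_space P"
    and "Xstar \<in> measurable P borel" and "Xstar \<in> space P \<rightarrow> D"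
    and "M \<in> measurable P (count_space masks)"
    and "prob_space.indep_var P borel Xstar (count_space masks) M"
    and "X 0 \<in> measurable P borel"
    and "AE \<omega> in P. M \<omega> * X 0 \<omega> = M \<omega> * Xstar \<omega>"
    and "\<And>t. t \<in> {1..T} \<Longrightarrow> Z t \<in> measurable P borel"
    and "\<And>t. t \<in> {1..T} \<Longrightarrow>
      is_arg_min (miri_objective P M (Z t) (X (t - 1))) (\<lambda>h. h \<in> imputers) (g t)"
    and "\<And>t. t \<in> {1..T} \<Longrightarrow> X t = imputed M (Z t) (X (t - 1)) (g t)"
  shows "\<forall>t\<in>{1..T}. mutual_info P borel (count_space masks) (X t) M
    \<le> mutual_info P borel (count_space masks) (X (t - 1)) M"
proof
  \<comment> \<open>Measurability propagates along the recursion, which is prescribed only up to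
    \<open>T\<close>.\<close>
  have meas: "t \<le> T \<Longrightarrow> X t \<in> borel_measurable P" for t
  proof (induction t)
    case (Suc t)
    then have "Suc t \<in> {1..T}" "X t \<in> borel_measurable P"
      by auto
    moreover have "g (Suc t) \<in> imputers"
      using assms(9)[OF \<open>Suc t \<in> {1..T}\<close>] by (simp only: is_arg_min_def)
    ultimately show ?case
      using measurable_imputed[OF _ assms(8) assms(4)] assms(10) by simp
  qed (simp add: assms(6))
  fix t assume t: "t \<in> {1..T}"
  let ?K = "count_space (masks :: (real ^ 'n) set)"
  let ?copy = "\<lambda>(z, x, m). x :: real ^ 'n"
  have Xt: "X t \<in> borel_measurable P" and Xt': "X (t - 1) \<in> borel_measurable P"
    using t by (auto intro!: meas)
  have copy: "?copy \<in> imputers"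
    unfolding imputers_def by measurable
  have "imputed M (Z t) (X (t - 1)) ?copy = X (t - 1)"
    by (simp add: imputed_def algebra_simps)
  then have copy_eq: "miri_objective P M (Z t) (X (t - 1)) ?copy = mutual_info P borel ?K (X (t - 1)) M"
    by (simp add: miri_objective_def mutual_info_def)
  \<comment> \<open>Here \<open>Q\<close> is the law of \<open>X (t - 1)\<close>, the first factor
    of the objective's reference measure.\<close>
  have "mutual_info P borel ?K (X t) M \<le> miri_objective P M (Z t) (X (t - 1)) (g t)"
    unfolding miri_objective_def assms(10)[OF t, symmetric]
    using assms(1) Xt assms(4) prob_space.prob_space_distr[OF assms(1) Xt']
    by (rule mutual_info_le_kl_div) simp
  \<comment> \<open>\<open>is_arg_min\<close> says that no competitor is strictly smaller; linearity
    of the order turns this into \<open>\<le>\<close>.\<close>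
  also have "\<dots> \<le> miri_objective P M (Z t) (X (t - 1)) ?copy"
    using assms(9)[OF t] copy unfolding is_arg_min_def by (meson not_less)
  finally show "mutual_info P borel ?K (X t) M \<le> mutual_info P borel ?K (X (t - 1)) M"
    unfolding copy_eq .
qed

end
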